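(* Let $P$ be a finite permutation matrix of bandwidth $w\ge1$, i.e. $w=\max_i|c_i(P)-i|$ where $c_i(P)$ is the column index of the $1$ in row $i$ of $P$. Then $P$ can be written as a product of fewer than $2w$ permutation matrices each of bandwidth at most $1$ (i.e. each factor $T=(t_{ij})$ satisfies $t_{ij}=0$ whenever $|i-j|>1$).
   Context: A permutation matrix is a square $0$-$1$ matrix with exactly one $1$ in each row and each column. A matrix $M=(m_{ij})$ has bandwidth at most $w$ if $m_{ij}=0$ whenever $|i-j|>w$; the bandwidth of a permutation matrix is the least such $w$. *)

theory Defs
  imports "Jordan_Normal_Form.Matrix"
begin

definition permutation_matrix :: "'a :: zero_neq_one mat \<Rightarrow> bool" where
  "permutation_matrix A \<longleftrightarrow>
     square_mat A \<and> elements_mat A \<subseteq> {0, 1} \<and>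
     (\<forall>i < dim_row A. \<exists>!j. j < dim_col A \<and> A $$ (i, j) = 1) \<and>
     (\<forall>j < dim_col A. \<exists>!i. i < dim_row A \<and> A $$ (i, j) = 1)"

definition bandwidth_at_most :: "'a :: zero mat \<Rightarrow> nat \<Rightarrow> bool" where
  "bandwidth_at_most A w \<longleftrightarrow>
     (\<forall>i < dim_row A. \<forall>j < dim_col A. \<bar>int i - int j\<bar> > int w \<longrightarrow> A $$ (i, j) = 0)"

definition bandwidth :: "'a :: zero mat \<Rightarrow> nat" where
  "bandwidth A = (LEAST w. bandwidth_at_most A w)"

text \<open>Matrices of a fixed size do not form a type of class \<open>monoid_mult\<close>, so \<open>prod_list\<close> does
  not apply; the size \<open>n\<close> determines the value of the empty product.\<close>

definition mat_prod_list :: "nat \<Rightarrow> 'a :: semiring_1 mat list \<Rightarrow> 'a mat" where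
  "mat_prod_list n As = foldr (*) As (1\<^sub>m n)"

definition column_of_one :: "'a :: zero_neq_one mat \<Rightarrow> nat \<Rightarrow> nat" where
  "column_of_one A i = (THE j. j < dim_col A \<and> A $$ (i, j) = 1)"

text \<open>For permutation matrices the bandwidth is the maximal displacement of a row's unit entry.\<close>

lemma bandwidth_eq_Max_displacement:
  fixes A :: "'a :: zero_neq_one mat"
  assumes A: "permutation_matrix A" and n: "dim_row A > 0"
  shows "int (bandwidth A) = Max ((\<lambda>i. \<bar>int (column_of_one A i) - int i\<bar>) ` {..<dim_row A})"
proof -
  let ?d = "\<lambda>i. \<bar>int (column_of_one A i) - int i\<bar>"
  let ?M = "Max (?d ` {..<dim_row A})"
  have c: "column_of_one A i < dim_col A" "A $$ (i, column_of_one A i) = 1"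
    if "i < dim_row A" for i
  proof -
    have "\<exists>!j. j < dim_col A \<and> A $$ (i, j) = 1"
      using A that unfolding permutation_matrix_def by blast
    from theI'[OF this]
    show "column_of_one A i < dim_col A" "A $$ (i, column_of_one A i) = 1"
      by (simp_all add: column_of_one_def)
  qed
  have zero: "A $$ (i, j) = 0"
    if "i < dim_row A" "j < dim_col A" "j \<noteq> column_of_one A i" for i j
  proof -
    have "A $$ (i, j) \<in> {0, 1}"
      using A that elements_matI[of A "dim_row A" "dim_col A" i j]
      unfolding permutation_matrix_def by (auto simp del: square_mat.simps)
    moreover have "\<exists>!j. j < dim_col A \<and> A $$ (i, j) = 1"
      using A that unfolding permutation_matrix_def by blast
    ultimately show ?thesis using c[OF that(1)] that by auto
  qed
  have "bandwidth_at_most A w \<longleftrightarrow> (\<forall>i < dim_row A. ?d i \<le> int w)" for w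
  proof
    assume *: "bandwidth_at_most A w"
    show "\<forall>i < dim_row A. ?d i \<le> int w"
    proof (intro allI impI, rule ccontr)
      fix i assume i: "i < dim_row A" and "\<not> ?d i \<le> int w"
      then have "\<bar>int i - int (column_of_one A i)\<bar> > int w" by linarith
      with * i c[OF i] show False by (auto simp: bandwidth_at_most_def)
    qed
  next
    assume *: "\<forall>i < dim_row A. ?d i \<le> int w"
    show "bandwidth_at_most A w"
      unfolding bandwidth_at_most_def
    proof (intro allI impI)
      fix i j assume ij: "i < dim_row A" "j < dim_col A" and gt: "\<bar>int i - int j\<bar> > int w"
      with * have "j \<noteq> column_of_one A i" by force
      with zero ij show "A $$ (i, j) = 0" by blast
    qed
  qed
  moreover have "(\<forall>i < dim_row A. ?d i \<le> int w) \<longleftrightarrow> ?M \<le> int w" for w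
    using n by (subst Max_le_iff) auto
  ultimately have iff: "bandwidth_at_most A w \<longleftrightarrow> ?M \<le> int w" for w by simp
  have "?d 0 \<le> ?M" using n by (intro Max_ge imageI finite_imageI) simp_all
  then have "?M \<ge> 0" by linarith
  then have "bandwidth A = nat ?M"
    unfolding bandwidth_def iff by (intro Least_equality) auto
  with \<open>?M \<ge> 0\<close> show ?thesis by simp
qed

end

theory Submission
  imports Defs "HOL-Combinatorics.Permutations"
begin

text \<open>The factors come from odd-even transposition sort, which in alternate rounds removes the
  descents at odd and at even positions. For a threshold k let c(x) be the number of positions
  below x that hold a value at least k; a round replaces c(x) by max (c(x-1)) (c(x+1)-1) at every
  active position x. By the band condition, c(x) exceeds its sorted value max 0 (x-k) by at most
  w - |x-k| at the start, and after t rounds by at most (2w-e-t-|x-k|) div 2, where e is 0 or 1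
  according to whether position k is active in the first round. Hence 2w-1 rounds suffice, except
  that for e = 1 the bound may fail initially, at x = k, if all w positions below k hold values at
  least k. In that case the permutation preserves the set of positions below k - w. So on an
  indecomposable permutation of {l..<r} this happens only for k = l + w, and the parity of the
  first round is chosen to make that position active; the general case is a direct sum.\<close>

section \<open>Threshold counts under one round of compare-and-swap\<close>

definition count_ge :: "(nat \<Rightarrow> nat) \<Rightarrow> nat \<Rightarrow> nat \<Rightarrow> nat" where
  "count_ge f k x = card {i. i < x \<and> k \<le> f i}"

text \<open>Position \<open>x\<close> stands for the boundary between entries \<open>x - 1\<close>
  and \<open>x\<close>; it is active when \<open>x + b\<close> is even, and only active boundaries
  are compared.\<close>

definition descent_swap :: "nat \<Rightarrow> (nat \<Rightarrow> nat) \<Rightarrow> nat \<Rightarrow> nat" where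
  "descent_swap b f i =
     (if 1 \<le> i \<and> even (i + b) \<and> f i < f (i - 1) then i - 1
      else if odd (i + b) \<and> f (i + 1) < f i then i + 1 else i)"

primrec odd_even_sort :: "nat \<Rightarrow> (nat \<Rightarrow> nat) \<Rightarrow> nat \<Rightarrow> nat \<Rightarrow> nat" where
  "odd_even_sort a f 0 = f"
| "odd_even_sort a f (Suc t) =
     odd_even_sort a f t \<circ> descent_swap (a + t) (odd_even_sort a f t)"

lemma count_ge_0 [simp]: "count_ge f k 0 = 0"
  by (simp add: count_ge_def)

lemma count_ge_Suc: "count_ge f k (Suc x) = count_ge f k x + (if k \<le> f x then 1 else 0)"
proof -
  have "{i. i < Suc x \<and> k \<le> f i} = (if k \<le> f x then insert x {i. i < x \<and> k \<le> f i} else {i. i < x \<and> k \<le> f i})"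
    by (auto simp: less_Suc_eq)
  then show ?thesis by (simp add: count_ge_def)
qed

lemma descent_swap_involution: "descent_swap b f (descent_swap b f i) = i"
  by (cases i) (auto simp: descent_swap_def)

lemma descent_swap_near: "descent_swap b f i \<le> Suc i" "i \<le> Suc (descent_swap b f i)"
  by (auto simp: descent_swap_def)

text \<open>No descent crosses an end of the interval: outside entries are fixed, so they are
  already in order with the values inside.\<close>

lemma descent_swap_permutes:
  assumes f: "f permutes {l..<r}"
  shows "descent_swap b f permutes {l..<r}"
proof -
  have "descent_swap b f i = i" if i: "i \<notin> {l..<r}" for i
  proof -
    have fi: "f i = i" using f i by (simp add: permutes_def)
    have *: "f j = j \<or> (j \<in> {l..<r} \<and> f j \<in> {l..<r})" for j
      using f permutes_in_image[OF f, of j] by (auto simp: permutes_def)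
    show ?thesis using i fi *[of "i - 1"] *[of "i + 1"]
      by (cases i) (auto simp: descent_swap_def)
  qed
  moreover have "\<exists>!x. descent_swap b f x = y" for y
    by (metis descent_swap_involution)
  ultimately show ?thesis by (simp add: permutes_def)
qed

text \<open>Each compared pair lies on one side of an inactive boundary, so the swap only permutes
  the entries below \<open>x\<close>.\<close>

lemma count_ge_swap_inactive:
  assumes "odd (x + b)"
  shows "count_ge (f \<circ> descent_swap b f) k x = count_ge f k x"
proof -
  let ?s = "descent_swap b f"
  have lt: "?s i < x" if "i < x" for i
    using that assms by (auto simp: descent_swap_def intro: Suc_lessI)
  have "bij_betw ?s {i. i < x \<and> k \<le> f (?s i)} {i. i < x \<and> k \<le> f i}"
    by (rule bij_betw_byWitness[where f' = ?s]) (auto simp: descent_swap_involution lt)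
  then show ?thesis by (simp add: count_ge_def bij_betw_same_card)
qed

text \<open>After the round, entry \<open>x\<close> is the smaller of the pair, so it reaches
  \<open>k\<close> exactly when both values do; the count below the inactive position
  \<open>x\<close> stays put.\<close>

lemma count_ge_swap_active:
  assumes "even (Suc x + b)"
  shows "count_ge (f \<circ> descent_swap b f) k (Suc x)
           = max (count_ge f k x) (count_ge f k (Suc (Suc x)) - 1)"
proof -
  have "descent_swap b f x = (if f (Suc x) < f x then Suc x else x)"
    using assms by (auto simp: descent_swap_def)
  then show ?thesis
    using assms by (auto simp: count_ge_Suc count_ge_swap_inactive)
qed

section \<open>The excess bound and its decay over the rounds\<close>

text \<open>With \<open>d = x - k\<close>, the first summand is the sorted count and the second the
  excess still allowed; \<open>A\<close> drops by one per round.\<close>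

definition excess_bound :: "int \<Rightarrow> int \<Rightarrow> int" where
  "excess_bound A d = max 0 d + max 0 ((A - \<bar>d\<bar>) div 2)"

lemma excess_bound_nonneg: "excess_bound A d \<ge> 0"
  by (simp add: excess_bound_def)

lemma excess_bound_left: "excess_bound A (d - 1) \<le> excess_bound (A - 1) d"
proof (cases "d \<ge> 1")
  case True
  then have "(A - \<bar>d - 1\<bar>) div 2 = (A - 1 - \<bar>d\<bar>) div 2 + 1" by simp
  then show ?thesis using True by (simp add: excess_bound_def)
next
  case False
  then have "A - \<bar>d - 1\<bar> = A - 1 - \<bar>d\<bar>" by simp
  then show ?thesis using False by (simp add: excess_bound_def)
qed

text \<open>Right neighbour. The \<open>- 1\<close> pays for the larger sorted part when
  \<open>d >= 0\<close> and for the extra halved unit when \<open>d < 0\<close>.\<close>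

lemma excess_bound_right: "excess_bound A (d + 1) - 1 \<le> excess_bound (A - 1) d"
proof (cases "d \<ge> 0")
  case True
  then have "A - \<bar>d + 1\<bar> = A - 1 - \<bar>d\<bar>" by simp
  then show ?thesis using True by (simp add: excess_bound_def)
next
  case False
  then have "(A - \<bar>d + 1\<bar>) div 2 = (A - 1 - \<bar>d\<bar>) div 2 + 1" by simp
  then show ?thesis using False by (simp add: excess_bound_def)
qed

text \<open>The floor hides the decrement, so an inactive position needs no progress.\<close>

lemma excess_bound_odd:
  assumes "odd (A - \<bar>d\<bar>)"
  shows "excess_bound (A - 1) d = excess_bound A d"
proof -
  obtain b where "A - \<bar>d\<bar> = 2 * b + 1" using assms by (rule oddE)
  moreover from this have "A - 1 - \<bar>d\<bar> = 2 * b" by simp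
  ultimately have "(A - 1 - \<bar>d\<bar>) div 2 = (A - \<bar>d\<bar>) div 2" by simp
  then show ?thesis by (simp add: excess_bound_def)
qed

text \<open>The parity of \<open>e\<close> makes \<open>2w - e - t - |x - k|\<close> odd exactly at
  the positions inactive in round \<open>t\<close>. There count and bound both stay; at active
  positions the bounds of the two neighbours yield the decrement.\<close>

lemma count_ge_odd_even_sort:
  assumes e: "even (e + a + k)"
    and init: "\<And>x. int (count_ge f k x) \<le> excess_bound (2 * int w - int e) (int x - int k)"
  shows "int (count_ge (odd_even_sort a f t) k x) \<le>
           excess_bound (2 * int w - int e - int t) (int x - int k)"
proof (induction t arbitrary: x)
  case 0
  then show ?case using init by simp
next
  case (Suc t)
  let ?f = "odd_even_sort a f t"
  let ?A = "2 * int w - int e - int t"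
  have A: "2 * int w - int e - int (Suc t) = ?A - 1" by simp
  show ?case
  proof (cases "even (x + (a + t))")
    case False
    have "odd (?A - \<bar>int x - int k\<bar>)" using False e by presburger
    then show ?thesis
      unfolding A odd_even_sort.simps count_ge_swap_inactive[OF False] excess_bound_odd
      by (metis Suc.IH excess_bound_odd)
  next
    case True
    show ?thesis
    proof (cases x)
      case 0
      then show ?thesis using excess_bound_nonneg by simp
    next
      case (Suc y)
      have "int (count_ge ?f k y) \<le> excess_bound (?A - 1) (int x - int k)"
        using Suc.IH[of y] excess_bound_left[of ?A "int x - int k"] by (simp add: Suc)
      moreover have "int (count_ge ?f k (Suc (Suc y)) - 1) \<le> excess_bound (?A - 1) (int x - int k)"
        using Suc.IH[of "Suc (Suc y)"] excess_bound_right[of ?A "int x - int k"]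
          excess_bound_nonneg[of "?A - 1" "int x - int k"] by (simp add: Suc algebra_simps)
      moreover have "count_ge (?f \<circ> descent_swap (a + t) ?f) k x
          = max (count_ge ?f k y) (count_ge ?f k (Suc (Suc y)) - 1)"
        using True count_ge_swap_active[of y "a + t" ?f k] by (simp only: Suc)
      ultimately show ?thesis
        unfolding A odd_even_sort.simps by (simp only: of_nat_max max.bounded_iff simp_thms)
    qed
  qed
qed

section \<open>Initial counts of a banded permutation\<close>

text \<open>Exactly \<open>k\<close> positions hold values below \<open>k\<close>. Splitting them at
  \<open>x\<close>, and splitting \<open>{..<x}\<close> by value, gives two sums that share the
  small values below \<open>x\<close>.\<close>

lemma count_ge_complement:
  assumes f: "f permutes {..<n}"
  shows "count_ge f k x + k = card {i. x \<le> i \<and> f i < k} + x"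
proof -
  have inj: "inj f" and sur: "surj f" using f by (simp_all add: permutes_inj permutes_surj)
  have "f ` {i. f i < k} = {..<k}"
    using surj_image_vimage_eq[OF sur, of "{..<k}"] by (simp add: vimage_def)
  then have k: "card {i. f i < k} = k"
    and fin: "finite {i. f i < k}"
    using card_image[of f "{i. f i < k}"] inj finite_imageD[of f "{i. f i < k}"]
    by (auto simp: inj_on_subset)
  have "{i. f i < k} = {i. x \<le> i \<and> f i < k} \<union> {i. i < x \<and> f i < k}" by auto
  then have 1: "k = card {i. x \<le> i \<and> f i < k} + card {i. i < x \<and> f i < k}"
    using k fin by (metis (no_types, lifting) card_Un_disjoint disjoint_iff finite_Un leD mem_Collect_eq)
  have "card {..<x} = card ({i. i < x \<and> k \<le> f i} \<union> {i. i < x \<and> f i < k})"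
    by (rule arg_cong[where f = card]) auto
  also have "\<dots> = card {i. i < x \<and> k \<le> f i} + card {i. i < x \<and> f i < k}"
    by (rule card_Un_disjoint) auto
  finally show ?thesis using 1 by (simp add: count_ge_def)
qed

text \<open>For \<open>x <= k\<close> the band confines the large values below \<open>x\<close> to
  an interval; for \<open>x > k\<close> it does so for the small values from \<open>x\<close> on,
  and the complement formula transfers the estimate.\<close>

lemma count_ge_banded:
  assumes f: "f permutes {..<n}" and bw: "\<And>i. f i \<le> i + w" "\<And>i. i \<le> f i + w"
  shows "int (count_ge f k x) \<le> max 0 (int x - int k) + max 0 (int w - \<bar>int x - int k\<bar>)"
proof (cases "x \<le> k")
  case True
  have "{i. i < x \<and> k \<le> f i} \<subseteq> {k - w..<x}"
    using bw(1) by (force simp: le_diff_conv intro: order_trans)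
  from card_mono[OF _ this] have "count_ge f k x \<le> x - (k - w)" by (simp add: count_ge_def)
  then show ?thesis using True by linarith
next
  case False
  have "{i. x \<le> i \<and> f i < k} \<subseteq> {x..<k + w}"
    using bw(2) by (force intro: le_less_trans)
  from card_mono[OF _ this] have "card {i. x \<le> i \<and> f i < k} \<le> k + w - x" by simp
  then show ?thesis using count_ge_complement[OF f, of k x] False by linarith
qed

text \<open>Saturation makes the \<open>w\<close> positions from \<open>k\<close> on hold small
  values, which by the band are exactly \<open>k - w\<close> to \<open>k - 1\<close>. Entries before
  \<open>k - w\<close> stay below \<open>k\<close> and find these values taken.\<close>

lemma saturated_count_ge_splits:
  assumes f: "f permutes {..<n}" and bw: "\<And>i. f i \<le> i + w" "\<And>i. i \<le> f i + w"
    and sat: "count_ge f k k = w" and i: "i < k - w"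
  shows "f i < k - w"
proof -
  have sub: "{i. k \<le> i \<and> f i < k} \<subseteq> {k..<k + w}"
    using bw(2) by (force intro: le_less_trans)
  have "card {i. k \<le> i \<and> f i < k} = w" using count_ge_complement[OF f, of k k] sat by simp
  then have eq: "{i. k \<le> i \<and> f i < k} = {k..<k + w}"
    using sub by (intro card_subset_eq) auto
  have inj: "inj f" using f by (rule permutes_inj)
  have "f j \<in> {k - w..<k}" if "j \<in> {k..<k + w}" for j
    proof -
    have "f j < k" using that eq by blast
    then show ?thesis using that bw(2)[of j] by auto
  qed
  \<comment> \<open>The existence of \<open>i\<close> gives \<open>w < k\<close>, so the difference
    is not truncated and both intervals have \<open>w\<close> elements.\<close>
  then have "f ` {k..<k + w} = {k - w..<k}"
    using i inj by (intro card_subset_eq) (auto simp: card_image inj_on_subset)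
  moreover have "f i \<notin> f ` {k..<k + w}" using inj i by (auto simp: inj_image_mem_iff)
  ultimately show ?thesis using bw(1)[of i] i by auto
qed

text \<open>By induction all smaller values are taken by fixed points, so \<open>f i\<close> cannot
  be less than \<open>i\<close>.\<close>

lemma permutes_no_excess_id:
  assumes f: "f permutes {..<n::nat}" and le: "\<And>i. f i \<le> i"
  shows "f = id"
proof
  fix i show "f i = id i"
  proof (induction i rule: less_induct)
    case (less i)
    then show ?case using le[of i] permutes_inj[OF f]
      by (metis id_apply injD le_neq_implies_less)
  qed
qed

section \<open>Factoring an indecomposable permutation\<close>

definition compose_all :: "('b \<Rightarrow> 'b) list \<Rightarrow> 'b \<Rightarrow> 'b" where
  "compose_all Ts = foldr (\<circ>) Ts id"

lemma compose_all_simps [simp]: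
  "compose_all [] = id" "compose_all (T # Ts) = T \<circ> compose_all Ts"
  by (simp_all add: compose_all_def)

text \<open>The length is exactly \<open>N\<close>, identities being allowed as factors, so that
  factorizations of adjacent blocks can be paired entry by entry.\<close>

definition factors_into :: "nat \<Rightarrow> nat \<Rightarrow> nat \<Rightarrow> (nat \<Rightarrow> nat) \<Rightarrow> bool" where
  "factors_into N l r f \<longleftrightarrow> (\<exists>Ts. length Ts = N \<and>
     (\<forall>T \<in> set Ts. T permutes {l..<r} \<and> (\<forall>i. T i \<le> Suc i \<and> i \<le> Suc (T i))) \<and>
     f = compose_all Ts)"

lemma odd_even_sort_permutes:
  "f permutes {l..<r} \<Longrightarrow> odd_even_sort a f t permutes {l..<r}"
proof (induction t)
  case (Suc t)
  then show ?case
    unfolding odd_even_sort.simps by (intro permutes_compose descent_swap_permutes)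
qed simp

text \<open>Each swap is its own inverse, so the rounds can be undone; the latest swap goes to the
  front of the list.\<close>

lemma odd_even_sort_factors:
  assumes f: "f permutes {l..<r}"
  shows "\<exists>Ts. length Ts = t \<and>
     (\<forall>T \<in> set Ts. T permutes {l..<r} \<and> (\<forall>i. T i \<le> Suc i \<and> i \<le> Suc (T i))) \<and>
     f = odd_even_sort a f t \<circ> compose_all Ts"
proof (induction t)
  case 0
  then show ?case by simp
next
  case (Suc t)
  then obtain Ts where Ts: "length Ts = t"
    "\<forall>T \<in> set Ts. T permutes {l..<r} \<and> (\<forall>i. T i \<le> Suc i \<and> i \<le> Suc (T i))"
    "f = odd_even_sort a f t \<circ> compose_all Ts" by blast
  let ?s = "descent_swap (a + t) (odd_even_sort a f t)"
  have "f = odd_even_sort a f (Suc t) \<circ> compose_all (?s # Ts)"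
    using Ts(3) by (simp add: fun_eq_iff descent_swap_involution)
  moreover have "?s permutes {l..<r}"
    by (intro descent_swap_permutes odd_even_sort_permutes f)
  ultimately show ?case
    using Ts(1,2) by (intro exI[of _ "?s # Ts"]) (metis descent_swap_near length_Cons set_ConsD)
qed

lemma indecomposable_factors:
  assumes f: "f permutes {l..<r}" and bw: "\<And>i. f i \<le> i + w" "\<And>i. i \<le> f i + w"
    and w: "w \<ge> 1"
    and indec: "\<not> (\<exists>m. l < m \<and> m < r \<and> (\<forall>i<m. f i < m))"
  shows "factors_into (2 * w - 1) l r f"
proof -
  \<comment> \<open>The offset \<open>l + w\<close> makes position \<open>l + w\<close> active in
    the first round.\<close>
  let ?g = "odd_even_sort (l + w) f (2 * w - 1)"
  have fn: "f permutes {..<r}" by (rule permutes_subset[OF f]) auto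
  have "count_ge ?g k k = 0" for k
  proof -
    define e where "e = (l + w + k) mod 2"
    have ecase: "e = 0 \<or> (e = 1 \<and> odd (l + w + k))" unfolding e_def by presburger
    have e: "e < 2" "even (e + (l + w) + k)" unfolding e_def by presburger+
    have unsat: "count_ge f k k \<noteq> w" if "e = 1"
    proof
      assume sat: "count_ge f k k = w"
      have sub: "{i. i < k \<and> k \<le> f i} \<subseteq> {k - w..<k}"
        using bw(1) by (force simp: le_diff_conv intro: order_trans)
      from card_mono[OF _ this] sat have kw: "w \<le> k" by (simp add: count_ge_def)
      have eq: "{i. i < k \<and> k \<le> f i} = {k - w..<k}"
        using sub sat kw by (intro card_subset_eq) (auto simp: count_ge_def)
      have "k - w \<in> {k - w..<k}" using w kw by auto
      then have fm: "k \<le> f (k - w)" using eq by blast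
      then have "f (k - w) \<noteq> k - w" using w kw by linarith
      then have m: "k - w \<in> {l..<r}" using f by (meson permutes_def)
      \<comment> \<open>Equality would make \<open>l + w + k\<close> even. Hence
        \<open>k - w\<close> lies strictly inside the interval and would be a splitting
        point.\<close>
      have "k - w \<noteq> l" using that ecase kw by auto
      with m indec have "\<not> (\<forall>i<k - w. f i < k - w)" by force
      then show False using saturated_count_ge_splits[OF fn bw sat] by blast
    qed
    have "int (count_ge f k x) \<le> excess_bound (2 * int w - int e) (int x - int k)" for x
    proof (cases "x = k \<and> e = 1")
      case True
      then have "count_ge f k k \<le> w - 1"
        using unsat count_ge_banded[OF fn bw, of k k] by simp
      \<comment> \<open>Here the bound is \<open>(2w - 1) div 2 = w - 1\<close>, one less than the
        band alone gives.\<close>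
      then show ?thesis using True w by (simp add: excess_bound_def)
    next
      case False
      \<comment> \<open>This is what lets the halved bound dominate the band estimate
        \<open>w - |x - k|\<close>.\<close>
      then have "int e \<le> \<bar>int x - int k\<bar>" using e(1) by (cases "x = k") auto
      then have "2 * (int w - \<bar>int x - int k\<bar>) \<le> 2 * int w - int e - \<bar>int x - int k\<bar>"
        by (simp add: algebra_simps)
      then have "int w - \<bar>int x - int k\<bar> \<le> (2 * int w - int e - \<bar>int x - int k\<bar>) div 2"
        by simp
      then show ?thesis
        using count_ge_banded[OF fn bw, of k x] unfolding excess_bound_def by linarith
    qed
    \<comment> \<open>At \<open>x = k\<close> the remaining allowance is
      \<open>(1 - e) div 2 = 0\<close>.\<close>
    from count_ge_odd_even_sort[OF e(2) this, of "2 * w - 1" k] w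
    show ?thesis by (simp add: excess_bound_def)
  qed
  then have "{i. i < k \<and> k \<le> ?g i} = {}" for k by (simp add: count_ge_def)
  \<comment> \<open>Use the threshold \<open>k = Suc i\<close>.\<close>
  then have "?g i \<le> i" for i by (metis (mono_tags, lifting) empty_Collect_eq lessI not_less_eq_eq)
  moreover have "?g permutes {..<r}"
    by (rule permutes_subset[OF odd_even_sort_permutes[OF f]]) auto
  ultimately have "?g = id" by (intro permutes_no_excess_id)
  then show ?thesis
    using odd_even_sort_factors[OF f, of "2 * w - 1" "l + w"] by (simp add: factors_into_def)
qed

section \<open>Direct sums of permutations\<close>

lemma compose_all_permutes:
  "\<forall>T \<in> set Ts. T permutes S \<Longrightarrow> compose_all Ts permutes S"
proof (induction Ts)
  case Nil
  show "compose_all [] permutes S" by (simp add: permutes_id)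
next
  case (Cons T Ts)
  then show "compose_all (T # Ts) permutes S" by (simp add: permutes_compose)
qed

lemma disjoint_permutes_commute:
  assumes "f permutes A" "g permutes B" "A \<inter> B = {}"
  shows "f \<circ> g = g \<circ> f"
proof
  fix x
  show "(f \<circ> g) x = (g \<circ> f) x"
  proof (cases "x \<in> A")
    case True
    then have "x \<notin> B" "f x \<notin> B"
      using assms(3) permutes_in_image[OF assms(1), of x] by auto
    then show ?thesis by (simp add: permutes_not_in[OF assms(2)])
  next
    case False
    have "g x \<notin> A"
      using False assms(3) permutes_in_image[OF assms(2), of x]
      by (cases "x \<in> B") (auto simp: permutes_not_in[OF assms(2)])
    then show ?thesis using False by (simp add: permutes_not_in[OF assms(1)])
  qed
qed

text \<open>Permutations of disjoint blocks commute, so the two lists merge entry by entry and the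
  number of factors does not grow.\<close>

lemma factors_into_append:
  assumes "factors_into N l m f" "factors_into N m r g" "l \<le> m" "m \<le> r"
  shows "factors_into N l r (f \<circ> g)"
proof -
  let ?ok = "\<lambda>l r T. T permutes {l..<r} \<and> (\<forall>i. T i \<le> Suc i \<and> i \<le> Suc (T i))"
  obtain Ts Us where Ts: "length Ts = N" "\<forall>T \<in> set Ts. ?ok l m T" "f = compose_all Ts"
    and Us: "length Us = N" "\<forall>T \<in> set Us. ?ok m r T" "g = compose_all Us"
    using assms(1,2) by (auto simp: factors_into_def)
  have ok: "?ok l r (T \<circ> U)" if T: "?ok l m T" and U: "?ok m r U" for T U
  proof (intro conjI allI)
    show "T \<circ> U permutes {l..<r}"
      using T U assms(3,4) by (intro permutes_compose permutes_subset[of _ _ "{l..<r}"]) auto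
    fix i
    \<comment> \<open>Either \<open>U\<close> fixes \<open>i\<close>, or \<open>U i\<close> lies in
      the right block, where \<open>T\<close> is the identity.\<close>
    have "T (U i) = T i \<or> T (U i) = U i"
      using T U permutes_in_image[of U "{m..<r}" i]
      by (cases "i \<in> {m..<r}") (auto simp: permutes_not_in)
    then show "(T \<circ> U) i \<le> Suc i" "i \<le> Suc ((T \<circ> U) i)" using T U by auto
  qed
  have "compose_all Ts \<circ> compose_all Us = compose_all (map2 (\<circ>) Ts Us)"
    using Ts(1,2) Us(1,2)
  proof (induction Ts Us arbitrary: N rule: list_induct2')
    case (4 T Ts U Us)
    let ?F = "compose_all Ts"
    have "?F \<circ> U = U \<circ> ?F"
      by (rule disjoint_permutes_commute[of _ "{l..<m}" _ "{m..<r}"])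
         (use 4 in \<open>auto intro!: compose_all_permutes\<close>)
    moreover have "?F \<circ> compose_all Us = compose_all (map2 (\<circ>) Ts Us)"
      using "4.prems" by (intro "4.IH"[of "length Ts"]) auto
    ultimately show "compose_all (T # Ts) \<circ> compose_all (U # Us)
        = compose_all (map2 (\<circ>) (T # Ts) (U # Us))"
      by (simp add: fun_eq_iff)
  qed auto
  moreover have "\<forall>T \<in> set (map2 (\<circ>) Ts Us). ?ok l r T"
  proof
    fix V assume "V \<in> set (map2 (\<circ>) Ts Us)"
    then obtain T U where "V = T \<circ> U" "T \<in> set Ts" "U \<in> set Us"
      by (auto dest: set_zip_leftD set_zip_rightD)
    then show "?ok l r V" using Ts(2) Us(2) ok[of T U] by simp
  qed
  ultimately show ?thesis
    using Ts Us unfolding factors_into_def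
    by (intro exI[of _ "map2 (\<circ>) Ts Us"]) simp
qed

text \<open>An injection of the finite set \<open>{..<m}\<close> into itself is onto, so
  \<open>f\<close> preserves the complement too and restricts to both sides. The last two conjuncts
  pass the band condition on to the pieces.\<close>

lemma permutes_split:
  assumes f: "f permutes {l..<r}" and m: "l < m" "m < r" "\<forall>i<m. f i < (m::nat)"
  shows "\<exists>g h. g permutes {l..<m} \<and> h permutes {m..<r} \<and> f = g \<circ> h \<and>
           (\<forall>i. g i = f i \<or> g i = i) \<and> (\<forall>i. h i = f i \<or> h i = i)"
proof -
  let ?g = "\<lambda>i. if i < m then f i else i" and ?h = "\<lambda>i. if i < m then i else f i"
  have inj: "inj f" using f by (rule permutes_inj)
  have "f ` {..<m} = {..<m}"
    using m inj by (intro card_subset_eq) (auto simp: card_image inj_on_subset)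
  then have ge: "m \<le> f i" if "m \<le> i" for i
    using that inj by (metis inj_image_mem_iff lessThan_iff not_le)
  have in_f: "f i \<in> {l..<r} \<longleftrightarrow> i \<in> {l..<r}" for i by (rule permutes_in_image[OF f])
  have out: "f i = i" if "i \<notin> {l..<r}" for i using f that by (rule permutes_not_in)
  have g: "?g permutes {l..<m}"
  proof (rule bij_imp_permutes)
    have "f i \<in> {l..<m}" if "i \<in> {l..<m}" for i
      using that m in_f[of i] by simp
    then have "?g ` {l..<m} = {l..<m}"
      using inj by (intro card_subset_eq) (auto simp: card_image inj_on_def inj_def)
    then show "bij_betw ?g {l..<m} {l..<m}" using inj by (auto simp: bij_betw_def inj_on_def inj_def)
  qed (use out in auto)
  have h: "?h permutes {m..<r}"
  proof (rule bij_imp_permutes)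
    have "f i \<in> {m..<r}" if "i \<in> {m..<r}" for i
      using that m(1) in_f[of i] ge[of i] by simp
    then have "?h ` {m..<r} = {m..<r}"
      using inj by (intro card_subset_eq) (auto simp: card_image inj_on_def inj_def)
    then show "bij_betw ?h {m..<r} {m..<r}" using inj by (auto simp: bij_betw_def inj_on_def inj_def)
  qed (use out in auto)
  have "f x = (?g \<circ> ?h) x" for x using ge[of x] by (cases "x < m") auto
  then have "f = ?g \<circ> ?h" by (rule ext)
  with g h show ?thesis by (intro exI[of _ ?g] exI[of _ ?h]) auto
qed

text \<open>Induction on the length of the interval, cutting at invariant initial segments until the
  blocks are indecomposable; \<open>w\<close> is kept for every block.\<close>

lemma banded_permutation_factors:
  assumes "f permutes {l..<r}" and "\<And>i. f i \<le> i + w" "\<And>i. i \<le> f i + w"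
    and w: "w \<ge> 1"
  shows "factors_into (2 * w - 1) l r f"
  using assms(1-3)
proof (induction "r - l" arbitrary: l r f rule: less_induct)
  case less
  show ?case
  proof (cases "\<exists>m. l < m \<and> m < r \<and> (\<forall>i<m. f i < m)")
    case False
    then show ?thesis using less.prems w by (intro indecomposable_factors) auto
  next
    case True
    then obtain m where m: "l < m" "m < r" "\<forall>i<m. f i < m" by blast
    obtain g h where gh: "g permutes {l..<m}" "h permutes {m..<r}" "f = g \<circ> h"
      "\<forall>i. g i = f i \<or> g i = i" "\<forall>i. h i = f i \<or> h i = i"
      using permutes_split[OF less.prems(1) m] by blast
    have bw: "g i \<le> i + w" "i \<le> g i + w" "h i \<le> i + w" "i \<le> h i + w" for i
      using gh(4,5) less.prems(2,3)[of i] by (metis le_add1)+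
    have "factors_into (2 * w - 1) l m g"
      using m gh(1) bw by (intro less.hyps) auto
    moreover have "factors_into (2 * w - 1) m r h"
      using m gh(2) bw by (intro less.hyps) auto
    ultimately show ?thesis using factors_into_append m gh(3) by auto
  qed
qed

section \<open>Translation between permutations and matrices\<close>

text \<open>The 1 of column \<open>j\<close> sits in row \<open>f j\<close>, so that products follow
  the order of composition; the band condition is symmetric in rows and columns.\<close>

definition perm_mat :: "nat \<Rightarrow> (nat \<Rightarrow> nat) \<Rightarrow> 'a :: zero_neq_one mat" where
  "perm_mat n f = mat n n (\<lambda>(i, j). if i = f j then 1 else 0)"

lemma perm_mat_carrier [simp]: "perm_mat n f \<in> carrier_mat n n"
  by (simp add: perm_mat_def)

lemma perm_mat_id: "perm_mat n id = 1\<^sub>m n"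
  by (rule eq_matI) (auto simp: perm_mat_def)

lemma perm_mat_comp:
  assumes "g permutes {..<n}"
  shows "perm_mat n (f \<circ> g) = (perm_mat n f * perm_mat n g :: 'a :: semiring_1 mat)"
proof (rule eq_matI)
  fix i j
  assume "i < dim_row (perm_mat n f * perm_mat n g :: 'a mat)"
    and "j < dim_col (perm_mat n f * perm_mat n g :: 'a mat)"
  then have ij: "i < n" "j < n" by (simp_all add: perm_mat_def)
  then have gj: "g j < n" using permutes_in_image[OF assms, of j] by simp
  have "(perm_mat n f * perm_mat n g :: 'a mat) $$ (i, j)
      = (\<Sum>k<n. (if i = f k then 1 else 0) * (if k = g j then 1 else 0))"
    using ij by (simp add: perm_mat_def scalar_prod_def lessThan_atLeast0)
  also have "\<dots> = (\<Sum>k<n. if k = g j then (if i = f k then 1 else 0) else 0)"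
    by (rule sum.cong) auto
  also have "\<dots> = (if i = f (g j) then 1 else 0)"
    using gj by (simp add: sum.delta)
  finally show "(perm_mat n (f \<circ> g) :: 'a mat) $$ (i, j) = (perm_mat n f * perm_mat n g) $$ (i, j)"
    using ij by (simp add: perm_mat_def)
qed (simp_all add: perm_mat_def)

lemma mat_prod_list_perm_mat:
  "\<forall>T \<in> set Ts. T permutes {..<n} \<Longrightarrow>
     mat_prod_list n (map (perm_mat n) Ts) = (perm_mat n (compose_all Ts) :: 'a :: semiring_1 mat)"
proof (induction Ts)
  case Nil
  show "mat_prod_list n (map (perm_mat n) []) = (perm_mat n (compose_all []) :: 'a mat)"
    by (simp add: mat_prod_list_def perm_mat_id)
next
  case (Cons T Ts)
  then have "compose_all Ts permutes {..<n}" by (intro compose_all_permutes) simp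
  from perm_mat_comp[OF this, of T, where 'a = 'a] Cons
  show "mat_prod_list n (map (perm_mat n) (T # Ts)) = (perm_mat n (compose_all (T # Ts)) :: 'a mat)"
    by (simp add: mat_prod_list_def)
qed

lemma permutation_matrix_perm_mat:
  assumes f: "f permutes {..<n}"
  shows "permutation_matrix (perm_mat n f :: 'a :: zero_neq_one mat)"
  unfolding permutation_matrix_def
proof (intro conjI allI impI)
  show "square_mat (perm_mat n f :: 'a mat)" by (simp add: perm_mat_def)
  show "elements_mat (perm_mat n f :: 'a mat) \<subseteq> {0, 1}"
    by (auto simp: perm_mat_def elements_mat_def)
  fix i assume "i < dim_row (perm_mat n f :: 'a mat)"
  then have i: "i < n" by (simp add: perm_mat_def)
  obtain j where j: "f j = i" using permutes_surj[OF f] by (metis surjD)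
  have jn: "j < n" using permutes_in_image[OF f, of j] i j by simp
  show "\<exists>!j. j < dim_col (perm_mat n f :: 'a mat) \<and> (perm_mat n f :: 'a mat) $$ (i, j) = 1"
    by (rule ex1I[of _ j])
       (use i j jn permutes_inj[OF f] in \<open>auto simp: perm_mat_def inj_def split: if_splits\<close>)
next
  fix j assume "j < dim_col (perm_mat n f :: 'a mat)"
  then have j: "j < n" by (simp add: perm_mat_def)
  have "f j < n" using permutes_in_image[OF f, of j] j by simp
  then show "\<exists>!i. i < dim_row (perm_mat n f :: 'a mat) \<and> (perm_mat n f :: 'a mat) $$ (i, j) = 1"
    using j by (intro ex1I[of _ "f j"]) (auto simp: perm_mat_def split: if_splits)
qed

lemma bandwidth_at_most_perm_mat:
  assumes "\<And>i. f i \<le> i + w" "\<And>i. i \<le> f i + w"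
  shows "bandwidth_at_most (perm_mat n f :: 'a :: zero_neq_one mat) w"
proof -
  have "\<not> int w < \<bar>int (f j) - int j\<bar>" for j using assms[of j] by linarith
  then show ?thesis by (auto simp: bandwidth_at_most_def perm_mat_def)
qed

lemma bandwidth_at_most_bandwidth: "bandwidth_at_most A (bandwidth A)"
  unfolding bandwidth_def
proof (rule LeastI)
  show "bandwidth_at_most A (dim_row A + dim_col A)" by (auto simp: bandwidth_at_most_def)
qed

text \<open>Take \<open>f j\<close> to be the row of the 1 in column \<open>j\<close>, and the
  identity from \<open>n\<close> on; uniqueness within rows makes \<open>f\<close>
  injective.\<close>

lemma permutation_matrix_obtains:
  assumes P: "(P :: 'a :: zero_neq_one mat) \<in> carrier_mat n n" "permutation_matrix P"
  obtains f where "f permutes {..<n}" "P = perm_mat n f"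
proof -
  have dims: "dim_row P = n" "dim_col P = n" using P(1) by auto
  have row: "\<exists>!j. j < n \<and> P $$ (i, j) = 1" if "i < n" for i
    using P(2) dims that by (simp add: permutation_matrix_def)
  have col: "\<exists>!i. i < n \<and> P $$ (i, j) = 1" if "j < n" for j
    using P(2) dims that by (simp add: permutation_matrix_def)
  define f where "f j = (if j < n then THE i. i < n \<and> P $$ (i, j) = 1 else j)" for j
  have f: "f j < n" "P $$ (f j, j) = 1" if "j < n" for j
    using theI'[OF col[OF that]] that by (simp_all add: f_def)
  have "inj_on f {..<n}"
    using row f by (intro inj_onI) (metis lessThan_iff)
  moreover from this have "f ` {..<n} = {..<n}"
    using f by (intro card_subset_eq) (auto simp: card_image)
  ultimately have "f permutes {..<n}"
    by (intro bij_imp_permutes) (auto simp: bij_betw_def f_def)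
  moreover have "P = perm_mat n f"
  proof (rule eq_matI)
    fix i j assume "i < dim_row (perm_mat n f :: 'a mat)" "j < dim_col (perm_mat n f :: 'a mat)"
    then have ij: "i < n" "j < n" by (simp_all add: perm_mat_def)
    have "P $$ (i, j) \<in> {0, 1}"
      using P(2) dims ij elements_matI[OF P(1), of i j] by (auto simp: permutation_matrix_def)
    moreover have "P $$ (i, j) = 1 \<longleftrightarrow> i = f j" using col f ij by blast
    ultimately show "P $$ (i, j) = perm_mat n f $$ (i, j)"
      using ij by (auto simp: perm_mat_def)
  qed (use dims in \<open>simp_all add: perm_mat_def\<close>)
  ultimately show thesis by (rule that)
qed

theorem theorem4p3:
  fixes P :: "'a :: semiring_1 mat" and n w :: nat
  assumes "P \<in> carrier_mat n n"
    and "permutation_matrix P"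
    and "bandwidth P = w"
    and "w \<ge> 1"
  shows "\<exists>Ts :: 'a mat list.
           length Ts < 2 * w \<and>
           (\<forall>T \<in> set Ts. T \<in> carrier_mat n n \<and> permutation_matrix T \<and> bandwidth_at_most T 1) \<and>
           P = mat_prod_list n Ts"
proof -
  obtain f where f: "f permutes {..<n}" and P: "P = perm_mat n f"
    using permutation_matrix_obtains[OF assms(1,2)] .
  have bw: "bandwidth_at_most P w" using bandwidth_at_most_bandwidth[of P] assms(3) by simp
  \<comment> \<open>The entry at \<open>(f i, i)\<close> is 1 and so must lie within the band; from
    \<open>n\<close> on \<open>f\<close> is the identity.\<close>
  have near: "\<bar>int (f i) - int i\<bar> \<le> int w" for i
  proof (cases "i < n")
    case True
    then have fi: "f i < n" using permutes_in_image[OF f, of i] by simp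
    then have "P $$ (f i, i) \<noteq> 0" using P True by (simp add: perm_mat_def)
    with bw fi True P have "\<not> int w < \<bar>int (f i) - int i\<bar>"
      unfolding bandwidth_at_most_def by (metis carrier_matD perm_mat_carrier)
    then show ?thesis by simp
  next
    case False
    then show ?thesis using permutes_not_in[OF f, of i] by simp
  qed
  have "factors_into (2 * w - 1) 0 n f"
  proof (rule banded_permutation_factors)
    show "f permutes {0..<n}" using f by (simp add: lessThan_atLeast0)
    show "f i \<le> i + w" "i \<le> f i + w" for i using near[of i] by linarith+
  qed (rule assms(4))
  then obtain Ts where Ts: "length Ts = 2 * w - 1"
    "\<forall>T \<in> set Ts. T permutes {..<n} \<and> (\<forall>i. T i \<le> Suc i \<and> i \<le> Suc (T i))"
    "f = compose_all Ts"
    by (auto simp: factors_into_def lessThan_atLeast0)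
  show ?thesis
  proof (intro exI[of _ "map (perm_mat n) Ts"] conjI)
    show "length (map (perm_mat n) Ts :: 'a mat list) < 2 * w" using Ts(1) assms(4) by simp
    show "\<forall>T \<in> set (map (perm_mat n) Ts). T \<in> carrier_mat n n \<and>
        permutation_matrix (T :: 'a mat) \<and> bandwidth_at_most T 1"
      using Ts(2) by (auto intro!: permutation_matrix_perm_mat bandwidth_at_most_perm_mat)
    show "P = mat_prod_list n (map (perm_mat n) Ts)"
      using Ts(2,3) P by (simp add: mat_prod_list_perm_mat)
  qed
qed

end
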